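(* For all nonnegative integers $k,m,n$ with $k\leq m$, $$\sum_{\nu=k}^m\frac{(-1)^{\nu}}{\nu+n+1}\binom{m}{\nu}\binom{\nu}{k}=\frac{(-1)^k}{n+m+1}\cdot\frac{\binom{n+k}{k}}{\binom{n+m}{m}}.$$ *)

theory Defs
  imports Complex_Main
begin

end

theory Submission imports Defs begin

text \<open>
  Trinomial revision, \<open>binom m \<nu> * binom \<nu> k = binom m k * binom (m - k) (\<nu> - k)\<close>, takes a factor
  that does not depend on \<open>\<nu>\<close> out of the sum. With \<open>j = \<nu> - k\<close>, \<open>N = m - k\<close> and \<open>a = n + k\<close>, what
  remains is the alternating sum of \<open>binom N j / (a + j + 1)\<close>, that is, up to sign, the \<open>N\<close>-th
  finite difference of \<open>x \<mapsto> 1 / (x + 1)\<close> at \<open>a\<close>. It equals \<open>a! N! / (a + N + 1)!\<close>, the value of the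
  Beta integral of \<open>t ^ a * (1 - t) ^ N\<close> over the unit interval, and both sides of the theorem
  become the same quotient of factorials.
\<close>

text \<open>
  Pascal's rule, read as the recursion that defines iterated finite differences.
\<close>

lemma alternating_binomial_sum_Suc:
  fixes f :: "nat \<Rightarrow> 'a::comm_ring_1"
  shows "(\<Sum>j\<le>Suc N. (-1) ^ j * of_nat (Suc N choose j) * f j)
    = (\<Sum>j\<le>N. (-1) ^ j * of_nat (N choose j) * f j)
      - (\<Sum>j\<le>N. (-1) ^ j * of_nat (N choose j) * f (Suc j))"
proof -
  \<comment> \<open>The additional term \<open>j = Suc N\<close> vanishes, so that the index can be shifted.\<close>
  have "(\<Sum>j\<le>N. (-1) ^ j * of_nat (N choose j) * f j)
      = (\<Sum>j\<le>Suc N. (-1) ^ j * of_nat (N choose j) * f j)"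
    by (simp add: binomial_eq_0)
  also have "\<dots> = f 0 - (\<Sum>j\<le>N. (-1) ^ j * of_nat (N choose Suc j) * f (Suc j))"
    by (subst sum.atMost_Suc_shift) (simp add: sum_negf)
  finally have shifted: "(\<Sum>j\<le>N. (-1) ^ j * of_nat (N choose j) * f j)
      = f 0 - (\<Sum>j\<le>N. (-1) ^ j * of_nat (N choose Suc j) * f (Suc j))" .
  show ?thesis
    unfolding shifted
    by (subst sum.atMost_Suc_shift) (simp add: algebra_simps sum.distrib sum_negf sum_subtractf)
qed

text \<open>
  The induction must vary \<open>a\<close>, because a difference step compares the sums at \<open>a\<close> and \<open>a + 1\<close>.
\<close>

lemma alternating_binomial_sum_reciprocal:
  "(\<Sum>j\<le>N. (-1) ^ j * real (N choose j) * (1 / real (a + j + 1)))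
    = fact a * fact N / fact (a + N + 1)"
proof (induction N arbitrary: a)
  case 0
  show ?case by simp
next
  case (Suc N)
  have "(\<Sum>j\<le>Suc N. (-1) ^ j * real (Suc N choose j) * (1 / real (a + j + 1)))
      = (\<Sum>j\<le>N. (-1) ^ j * real (N choose j) * (1 / real (a + j + 1)))
        - (\<Sum>j\<le>N. (-1) ^ j * real (N choose j) * (1 / real (Suc a + j + 1)))"
    using alternating_binomial_sum_Suc[of N "\<lambda>j. 1 / real (a + j + 1)"] by simp
  also have "\<dots> = fact a * fact N / fact (a + N + 1) - fact (Suc a) * fact N / fact (Suc a + N + 1)"
    by (simp only: Suc.IH)
  also have "\<dots> = fact a * fact (Suc N) / fact (a + Suc N + 1)"
  proof -
    have "fact (a + N + 2) = real (a + N + 2) * fact (a + N + 1)"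
      by simp
    then have "fact a * fact N / fact (a + N + 1)
        = real (a + N + 2) * (fact a * fact N) / (fact (a + N + 2) :: real)"
      by (simp del: fact_Suc)
    moreover have "fact (Suc a) * fact N = real (a + 1) * (fact a * fact N)"
      and "fact a * fact (Suc N) = real (N + 1) * (fact a * fact N)"
      by simp_all
    ultimately show ?thesis
      by (simp add: diff_divide_distrib[symmetric] algebra_simps del: fact_Suc)
  qed
  finally show ?case .
qed

theorem mainTheorem5:
  fixes k m n :: nat
  assumes "k \<le> m"
  shows "(\<Sum>\<nu>=k..m. (-1) ^ \<nu> / real (\<nu> + n + 1) * real (m choose \<nu>) * real (\<nu> choose k))
    = (-1) ^ k / real (n + m + 1) * (real ((n + k) choose k) / real ((n + m) choose m))"
proof -
  obtain N where m: "m = k + N"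
    using assms le_Suc_ex by blast
  have revision: "real (m choose (j + k)) * real ((j + k) choose k)
      = real (m choose k) * real (N choose j)" if "j \<le> N" for j
    using choose_mult[of k "j + k" m] that m by (simp flip: of_nat_mult)
  have reindex: "sum g {k..m} = (\<Sum>j\<le>N. g (j + k))" for g :: "nat \<Rightarrow> real"
    using sum.shift_bounds_cl_nat_ivl[of g 0 k N] by (simp add: m atMost_atLeast0 add.commute)
  have "(\<Sum>\<nu>=k..m. (-1) ^ \<nu> / real (\<nu> + n + 1) * real (m choose \<nu>) * real (\<nu> choose k))
      = (\<Sum>j\<le>N. (-1) ^ (j + k) / real (j + k + n + 1)
          * (real (m choose (j + k)) * real ((j + k) choose k)))"
    unfolding reindex by (simp only: mult.assoc)
  also have "\<dots> = (\<Sum>j\<le>N. ((-1) ^ k * real (m choose k))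
      * ((-1) ^ j * real (N choose j) * (1 / real ((n + k) + j + 1))))"
    by (rule sum.cong) (simp_all add: revision power_add ac_simps)
  also have "\<dots> = (-1) ^ k * real (m choose k) * (fact (n + k) * fact N / fact (n + m + 1))"
    by (simp only: sum_distrib_left[symmetric] alternating_binomial_sum_reciprocal)
       (simp add: m ac_simps)
  also have "\<dots> = (-1) ^ k / real (n + m + 1)
      * (real ((n + k) choose k) / real ((n + m) choose m))"
  proof -
    have "real (m choose k) = fact m / (fact k * fact N)"
      and "real ((n + k) choose k) = fact (n + k) / (fact k * fact n)"
      and "real ((n + m) choose m) = fact (n + m) / (fact m * fact n)"
      by (simp_all add: m binomial_fact)
    moreover have "fact (n + m + 1) = real (n + m + 1) * fact (n + m)"
      by simp
    ultimately show ?thesis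
      by (simp add: ac_simps del: fact_Suc of_nat_add)
  qed
  finally show ?thesis .
qed

end
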